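(* Let $f:\{0,1\}^n\to\mathbb{R}$ with $\min_{x\in\{0,1\}^n}f(x)=0$ and $\max_{x\in\{0,1\}^n}f(x)=1$. If the Lasserre relaxation at level $n-1$ of the unconstrained problem $\min\{f(x)\mid x\in\{0,1\}^n\}$ has an integrality gap, then $f$ (written as its unique multilinear polynomial representation) is a multivariate polynomial of degree $n$.
   Context: $N=\{1,\dots,n\}$. Every $f:\{0,1\}^n\to\mathbb{R}$ has a unique representation $f(x)=\sum_{I\subseteq N}f_I\prod_{i\in I}x_i$. $\mathcal{P}_t(N)$ is the set of subsets of $N$ of size at most $t$; $M_t(y)$ is the matrix indexed by $\mathcal{P}_t(N)$ with $(I,J)$-entry $y_{I\cup J}$. The level-$(n-1)$ Lasserre relaxation is $\min\{\sum_If_Iy_I\mid y\in\mathbb{R}^{\mathcal{P}_{2n-2}(N)},\ y_\varnothing=1,\ M_{n-1}(y)\succeq0\}$; it has an integrality gap if its optimal value is strictly smaller than $\min_xf(x)$. *)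

theory Defs
  imports "HOL-Analysis.Analysis"
begin

definition cube :: "nat \<Rightarrow> (nat \<Rightarrow> real) set" where
  "cube n = {1..n} \<rightarrow>\<^sub>E {0, 1}"

text \<open>Functions on the cube are total functions whose values outside \<^term>\<open>cube n\<close> are never used.
  Coefficient families are normalised to vanish outside the subsets of \<open>{1..n}\<close>, so that the
  family representing a given function is unique as a HOL function.\<close>

definition multilinear_rep :: "nat \<Rightarrow> ((nat \<Rightarrow> real) \<Rightarrow> real) \<Rightarrow> (nat set \<Rightarrow> real) \<Rightarrow> bool" where
  "multilinear_rep n f c \<longleftrightarrow>
     (\<forall>I. \<not> I \<subseteq> {1..n} \<longrightarrow> c I = 0) \<and>
     (\<forall>x\<in>cube n. f x = (\<Sum>I\<in>Pow {1..n}. c I * (\<Prod>i\<in>I. x i)))"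

definition multilinear_coeff :: "nat \<Rightarrow> ((nat \<Rightarrow> real) \<Rightarrow> real) \<Rightarrow> nat set \<Rightarrow> real" where
  "multilinear_coeff n f = (THE c. multilinear_rep n f c)"

text \<open>Degree of the multilinear polynomial: its monomials are indexed by the sets \<open>I\<close>, and the
  monomial of \<open>I\<close> has total degree \<^term>\<open>card I\<close>. The zero polynomial gets degree 0.\<close>

definition multilinear_degree :: "nat \<Rightarrow> ((nat \<Rightarrow> real) \<Rightarrow> real) \<Rightarrow> nat" where
  "multilinear_degree n f = Max (insert 0 (card ` {I. I \<subseteq> {1..n} \<and> multilinear_coeff n f I \<noteq> 0}))"

definition subsets_upto :: "nat \<Rightarrow> nat \<Rightarrow> nat set set" where
  "subsets_upto t n = {I. I \<subseteq> {1..n} \<and> card I \<le> t}"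

text \<open>A real matrix with finite row and column index set \<open>A\<close> is a function of two arguments,
  of which only the values on \<open>A\<close> matter.\<close>

definition psd_on :: "'i set \<Rightarrow> ('i \<Rightarrow> 'i \<Rightarrow> real) \<Rightarrow> bool" where
  "psd_on A M \<longleftrightarrow>
     (\<forall>i\<in>A. \<forall>j\<in>A. M i j = M j i) \<and>
     (\<forall>v. 0 \<le> (\<Sum>i\<in>A. \<Sum>j\<in>A. v i * M i j * v j))"

definition moment_matrix :: "(nat set \<Rightarrow> real) \<Rightarrow> nat set \<Rightarrow> nat set \<Rightarrow> real" where
  "moment_matrix y I J = y (I \<union> J)"

text \<open>The vectors \<open>y\<close> are total functions: the constraints at level \<open>t\<close> only involve the entries
  indexed by \<^term>\<open>subsets_upto (2 * t) n\<close>, and for \<open>2 * t \<ge> n\<close> these are all subsets of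
  \<open>{1..n}\<close>, i.e. exactly the entries occurring in the objective.\<close>

definition lasserre_feasible :: "nat \<Rightarrow> nat \<Rightarrow> (nat set \<Rightarrow> real) set" where
  "lasserre_feasible n t = {y. y {} = 1 \<and> psd_on (subsets_upto t n) (moment_matrix y)}"

definition lasserre_objective :: "nat \<Rightarrow> ((nat \<Rightarrow> real) \<Rightarrow> real) \<Rightarrow> (nat set \<Rightarrow> real) \<Rightarrow> real" where
  "lasserre_objective n f y = (\<Sum>I\<in>Pow {1..n}. multilinear_coeff n f I * y I)"

text \<open>The infimum is taken in the extended reals, so that the optimal value is meaningful
  without a separate attainment or boundedness argument.\<close>

definition lasserre_value :: "nat \<Rightarrow> nat \<Rightarrow> ((nat \<Rightarrow> real) \<Rightarrow> real) \<Rightarrow> ereal" where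
  "lasserre_value n t f = (INF y\<in>lasserre_feasible n t. ereal (lasserre_objective n f y))"

definition integrality_gap :: "nat \<Rightarrow> nat \<Rightarrow> ((nat \<Rightarrow> real) \<Rightarrow> real) \<Rightarrow> bool" where
  "integrality_gap n t f \<longleftrightarrow> lasserre_value n t f < ereal (Min (f ` cube n))"

text \<open>Existence and uniqueness of the multilinear representation, which justify the definite
  description in \<^const>\<open>multilinear_coeff\<close>.\<close>

definition vertex :: "nat \<Rightarrow> nat set \<Rightarrow> nat \<Rightarrow> real" where
  "vertex n S = (\<lambda>i\<in>{1..n}. if i \<in> S then 1 else 0)"

lemma cube_eq_vertices: "cube n = vertex n ` Pow {1..n}"
proof
  show "vertex n ` Pow {1..n} \<subseteq> cube n"
    by (auto simp: cube_def vertex_def split: if_splits)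
  show "cube n \<subseteq> vertex n ` Pow {1..n}"
  proof
    fix x assume x: "x \<in> cube n"
    have "x = vertex n {i\<in>{1..n}. x i = 1}"
    proof
      fix i
      show "x i = vertex n {i\<in>{1..n}. x i = 1} i"
      proof (cases "i \<in> {1..n}")
        case True
        then have "x i \<in> {0, 1}" using x PiE_mem unfolding cube_def by fast
        then show ?thesis using True by (auto simp: vertex_def)
      next
        case False
        then show ?thesis using x PiE_arb unfolding cube_def vertex_def by fastforce
      qed
    qed
    then show "x \<in> vertex n ` Pow {1..n}" by blast
  qed
qed

lemma sum_at_vertex:
  assumes "S \<subseteq> {1..n}"
  shows "(\<Sum>I\<in>Pow {1..n}. c I * (\<Prod>i\<in>I. vertex n S i)) = sum c (Pow S)"
proof -
  have "(\<Prod>i\<in>I. vertex n S i) = (if I \<subseteq> S then 1 else 0)" if "I \<subseteq> {1..n}" for I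
  proof (cases "I \<subseteq> S")
    case True
    then have "\<forall>i\<in>I. vertex n S i = 1" using that by (auto simp: vertex_def)
    then show ?thesis using True by simp
  next
    case False
    then obtain i where "i \<in> I" "i \<notin> S" by blast
    then have "vertex n S i = 0" using that by (auto simp: vertex_def)
    moreover have "finite I" using that finite_subset by blast
    ultimately have "(\<Prod>i\<in>I. vertex n S i) = 0" using \<open>i \<in> I\<close> prod_zero by blast
    then show ?thesis using False by simp
  qed
  then have "(\<Sum>I\<in>Pow {1..n}. c I * (\<Prod>i\<in>I. vertex n S i)) =
      (\<Sum>I\<in>Pow {1..n}. if I \<in> Pow S then c I else 0)"
    by (intro sum.cong) auto
  also have "\<dots> = sum c (Pow {1..n} \<inter> Pow S)"
    by (simp add: sum.inter_restrict)
  also have "Pow {1..n} \<inter> Pow S = Pow S" using assms by blast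
  finally show ?thesis .
qed

lemma multilinear_rep_iff:
  "multilinear_rep n f c \<longleftrightarrow>
     (\<forall>I. \<not> I \<subseteq> {1..n} \<longrightarrow> c I = 0) \<and> (\<forall>S\<subseteq>{1..n}. f (vertex n S) = sum c (Pow S))"
  unfolding multilinear_rep_def cube_eq_vertices ball_simps(9) by (simp only: Ball_def Pow_iff sum_at_vertex cong: imp_cong)

lemma subset_sums_exist:
  fixes g :: "'a set \<Rightarrow> real"
  assumes "finite A"
  shows "\<exists>c. \<forall>S\<subseteq>A. g S = sum c (Pow S)"
  using assms
proof (induction A arbitrary: g rule: finite_induct)
  case empty
  show ?case by (rule exI[of _ g]) simp
next
  case (insert a A)
  obtain c where c: "\<forall>S\<subseteq>A. g S = sum c (Pow S)" using insert.IH by blast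
  obtain d where d: "\<forall>S\<subseteq>A. g (insert a S) - g S = sum d (Pow S)"
    using insert.IH[of "\<lambda>S. g (insert a S) - g S"] by blast
  define e where "e I = (if a \<in> I then d (I - {a}) else c I)" for I
  have base: "sum e (Pow S) = g S" if "S \<subseteq> A" for S
  proof -
    have "sum e (Pow S) = sum c (Pow S)"
      using that insert.hyps by (intro sum.cong) (auto simp: e_def)
    then show ?thesis using c that by simp
  qed
  have "g S = sum e (Pow S)" if S: "S \<subseteq> insert a A" for S
  proof (cases "a \<in> S")
    case False
    then show ?thesis using S base[of S] by (simp add: subset_insert)
  next
    case True
    define T where "T = S - {a}"
    have T: "S = insert a T" "a \<notin> T" "T \<subseteq> A" using True S by (auto simp: T_def)
    have fin: "finite T" using T insert.hyps finite_subset by blast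
    have inj: "inj_on (insert a) (Pow T)" using T by (auto simp: inj_on_def)
    have "sum e (Pow S) = sum e (Pow T) + sum e (insert a ` Pow T)"
      unfolding T(1) Pow_insert using fin T(2) by (intro sum.union_disjoint) auto
    also have "sum e (insert a ` Pow T) = (\<Sum>I\<in>Pow T. e (insert a I))"
      using inj by (simp add: sum.reindex)
    also have "\<dots> = sum d (Pow T)"
    proof (rule sum.cong[OF refl])
      fix I assume "I \<in> Pow T"
      then have "insert a I - {a} = I" using T by blast
      then show "e (insert a I) = d I" by (simp add: e_def)
    qed
    finally show ?thesis using base[OF T(3)] d T by auto
  qed
  then show ?case by blast
qed

lemma subset_sums_unique:
  fixes c d :: "'a set \<Rightarrow> real"
  assumes "finite S" "\<forall>T\<subseteq>S. sum c (Pow T) = sum d (Pow T)"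
  shows "c S = d S"
  using assms
proof (induction S rule: finite_psubset_induct)
  case (psubset S)
  have "sum c (Pow S - {S}) = sum d (Pow S - {S})"
  proof (rule sum.cong[OF refl])
    fix T assume T: "T \<in> Pow S - {S}"
    then have "T \<subset> S" by blast
    moreover have "\<forall>U\<subseteq>T. sum c (Pow U) = sum d (Pow U)" using psubset.prems T by blast
    ultimately show "c T = d T" by (rule psubset.IH)
  qed
  moreover have "sum h (Pow S) = h S + sum h (Pow S - {S})" for h :: "'a set \<Rightarrow> real"
    using psubset.hyps by (intro sum.remove) auto
  ultimately show ?case using psubset.prems by (metis add_right_cancel order_refl)
qed

lemma multilinear_rep_ex1: "\<exists>!c. multilinear_rep n f c"
proof (rule ex_ex1I)
  obtain c where c: "\<forall>S\<subseteq>{1..n}. f (vertex n S) = sum c (Pow S)"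
    using subset_sums_exist[of "{1..n}" "\<lambda>S. f (vertex n S)"] by auto
  define d where "d I = (if I \<subseteq> {1..n} then c I else 0)" for I
  have "sum d (Pow S) = sum c (Pow S)" if "S \<subseteq> {1..n}" for S
    using that by (intro sum.cong) (auto simp: d_def)
  with c have "multilinear_rep n f d" by (simp add: multilinear_rep_iff d_def)
  then show "\<exists>c. multilinear_rep n f c" by blast
next
  fix c d
  assume c: "multilinear_rep n f c" and d: "multilinear_rep n f d"
  show "c = d"
  proof
    fix I
    show "c I = d I"
    proof (cases "I \<subseteq> {1..n}")
      case True
      then have "finite I" using finite_subset by blast
      moreover have "\<forall>T\<subseteq>I. sum c (Pow T) = sum d (Pow T)"
        using c d True unfolding multilinear_rep_iff by (metis subset_trans)
      ultimately show ?thesis by (rule subset_sums_unique)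
    next
      case False
      then show ?thesis using c d by (simp add: multilinear_rep_iff)
    qed
  qed
qed

lemma multilinear_rep_coeff: "multilinear_rep n f (multilinear_coeff n f)"
  unfolding multilinear_coeff_def by (rule theI'[OF multilinear_rep_ex1])

end

theory Submission
  imports Defs
begin

text \<open>If the coefficient of the top monomial vanishes, then \<open>f\<close> has the same total mass \<open>F\<close> on the
  even and on the odd vertices. Hence a nonnegative such \<open>f\<close> is the conical combination of the
  functions \<open>1\<^sub>A + 1\<^sub>B\<close>, \<open>A\<close> even and \<open>B\<close> odd, with weights \<open>f A * f B / F\<close>. Each
  \<open>1\<^sub>A + 1\<^sub>B\<close> is its own square and again has no top monomial, so it is a square of a polynomial
  of degree at most \<open>n - 1\<close>, and the relaxation certifies \<open>f \<ge> 0\<close>.\<close>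

text \<open>Moebius inversion on the subset lattice. For \<open>S = {1..n}\<close> it reads the top
  coefficient off as the even vertex mass minus the odd one, up to sign.\<close>

lemma alternating_sum_subset_sums:
  fixes c :: "'a set \<Rightarrow> real"
  assumes "finite S"
  shows "(\<Sum>T\<in>Pow S. (-1) ^ card T * sum c (Pow T)) = (-1) ^ card S * c S"
  by (rule inclusion_exclusion_symmetric[symmetric])
    (simp_all add: assms flip: power_add mult.assoc)

text \<open>Complementation turns superset sums into subset sums. Here \<open>z\<close> is the
  signed measure on the vertices whose moments are \<open>y\<close>; its weights may be
  negative.\<close>

lemma superset_sums_exist:
  fixes y :: "'a set \<Rightarrow> real"
  assumes "finite N"
  obtains z where "\<And>I. I \<subseteq> N \<Longrightarrow> y I = (\<Sum>S\<in>Pow N. if I \<subseteq> S then z S else 0)"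
proof -
  obtain c where c: "\<forall>S\<subseteq>N. y (N - S) = sum c (Pow S)"
    using subset_sums_exist[OF assms, of "\<lambda>S. y (N - S)"] by blast
  have "y I = (\<Sum>S\<in>Pow N. if I \<subseteq> S then c (N - S) else 0)" if I: "I \<subseteq> N" for I
  proof -
    have "y I = sum c (Pow (N - I))"
      using c[rule_format, of "N - I"] I by (simp add: double_diff)
    also have "\<dots> = (\<Sum>S\<in>{S\<in>Pow N. I \<subseteq> S}. c (N - S))"
      by (rule sum.reindex_bij_witness[of _ "\<lambda>S. N - S" "\<lambda>S. N - S"])
        (use I in \<open>auto intro!: arg_cong[where f = c]\<close>)
    also have "\<dots> = (\<Sum>S\<in>Pow N. if I \<subseteq> S then c (N - S) else 0)"
      by (rule sum.inter_filter) (simp add: assms)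
    finally show ?thesis .
  qed
  then show thesis by (rule that)
qed

text \<open>Swapping the two sums turns the pairing of coefficients with moments into the integral
  of the polynomial against the signed measure \<open>z\<close>.\<close>

lemma sum_superset_sums:
  fixes z c :: "'a set \<Rightarrow> real"
  assumes "finite N"
  shows "(\<Sum>I\<in>Pow N. c I * (\<Sum>S\<in>Pow N. if I \<subseteq> S then z S else 0)) =
    (\<Sum>S\<in>Pow N. z S * sum c (Pow S))"
proof -
  have "(\<Sum>I\<in>Pow N. c I * (\<Sum>S\<in>Pow N. if I \<subseteq> S then z S else 0)) =
      (\<Sum>S\<in>Pow N. \<Sum>I\<in>Pow N. if I \<in> Pow S then z S * c I else 0)"
    unfolding sum_distrib_left by (subst sum.swap) (auto intro!: sum.cong)
  also have "\<dots> = (\<Sum>S\<in>Pow N. \<Sum>I\<in>Pow N \<inter> Pow S. z S * c I)"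
    using assms by (simp add: sum.inter_restrict)
  also have "\<dots> = (\<Sum>S\<in>Pow N. z S * sum c (Pow S))"
    unfolding sum_distrib_left by (intro sum.cong) auto
  finally show ?thesis .
qed

text \<open>Passing from coefficients to vertex values diagonalises the full moment matrix, with the
  weights \<open>z\<close> on the diagonal.\<close>

lemma moment_quadratic_form:
  fixes y z v :: "nat set \<Rightarrow> real"
  assumes fin: "finite N"
    and z: "\<And>I. I \<subseteq> N \<Longrightarrow> y I = (\<Sum>S\<in>Pow N. if I \<subseteq> S then z S else 0)"
  shows "(\<Sum>I\<in>Pow N. \<Sum>J\<in>Pow N. v I * moment_matrix y I J * v J) =
    (\<Sum>S\<in>Pow N. z S * (sum v (Pow S))\<^sup>2)"
proof -
  have "(\<Sum>J\<in>Pow N. v I * moment_matrix y I J * v J) =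
      v I * (\<Sum>S\<in>Pow N. if I \<subseteq> S then z S * sum v (Pow S) else 0)" if I: "I \<in> Pow N" for I
  proof -
    have "(\<Sum>J\<in>Pow N. v I * moment_matrix y I J * v J) =
        v I * (\<Sum>J\<in>Pow N. v J * (\<Sum>S\<in>Pow N. if J \<subseteq> S then if I \<subseteq> S then z S else 0 else 0))"
      unfolding sum_distrib_left[of "v I"]
    proof (rule sum.cong[OF refl])
      fix J assume "J \<in> Pow N"
      then have "moment_matrix y I J =
          (\<Sum>S\<in>Pow N. if J \<subseteq> S then if I \<subseteq> S then z S else 0 else 0)"
        using I z[of "I \<union> J"] by (auto simp: moment_matrix_def intro!: sum.cong)
      then show "v I * moment_matrix y I J * v J =
          v I * (v J * (\<Sum>S\<in>Pow N. if J \<subseteq> S then if I \<subseteq> S then z S else 0 else 0))"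
        by simp
    qed
    also have "\<dots> = v I * (\<Sum>S\<in>Pow N. (if I \<subseteq> S then z S else 0) * sum v (Pow S))"
      by (simp only: sum_superset_sums[OF fin])
    finally show ?thesis by (simp add: if_distrib[of "\<lambda>a. a * _"] cong: if_cong)
  qed
  then have "(\<Sum>I\<in>Pow N. \<Sum>J\<in>Pow N. v I * moment_matrix y I J * v J) =
      (\<Sum>S\<in>Pow N. z S * sum v (Pow S) * sum v (Pow S))"
    by (simp add: sum_superset_sums[OF fin, symmetric])
  then show ?thesis by (simp add: power2_eq_square mult.assoc)
qed

text \<open>The test vector \<open>v\<close> holds the coefficients of the indicator of the vertices
  \<open>A\<close> and \<open>B\<close>. Their opposite parities cancel its top coefficient, so
  \<open>v\<close> lives on the index set of level \<open>n - 1\<close>.\<close>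

lemma feasible_pair_nonneg:
  assumes y: "psd_on (subsets_upto (n - 1) n) (moment_matrix y)"
    and z: "\<And>I. I \<subseteq> {1..n} \<Longrightarrow> y I = (\<Sum>S\<in>Pow {1..n}. if I \<subseteq> S then z S else 0)"
    and A: "A \<subseteq> {1..n}" "even (card A)" and B: "B \<subseteq> {1..n}" "odd (card B)"
  shows "0 \<le> z A + z B"
proof -
  let ?N = "{1..n}"
  define g where "g S = (if S = A then 1 else 0) + (if S = B then 1 else (0::real))" for S
  have "A \<noteq> B" using A B by auto
  obtain v where v: "\<forall>S\<subseteq>?N. g S = sum v (Pow S)"
    using subset_sums_exist[of ?N g] by auto
  have "(-1) ^ n * v ?N = (\<Sum>S\<in>Pow ?N. (-1) ^ card S * g S)"
    using alternating_sum_subset_sums[of ?N v] v by simp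
  also have "\<dots> = 0"
    using A B by (simp add: g_def distrib_left sum.distrib if_distrib[of "\<lambda>a. _ * a"] cong: if_cong)
  finally have top: "v ?N = 0" by simp
  have sub: "subsets_upto (n - 1) n \<subseteq> Pow ?N" by (auto simp: subsets_upto_def)
  have outside: "v I = 0" if "I \<in> Pow ?N - subsets_upto (n - 1) n" for I
  proof -
    have "I \<subseteq> ?N" "n - 1 < card I" using that by (auto simp: subsets_upto_def)
    \<comment> \<open>Only the full set has more than \<open>n - 1\<close> elements. For
      \<open>n = 0\<close> the truncated level is 0 and no such \<open>I\<close> exists.\<close>
    then have "I = ?N" using card_mono[of ?N I] by (intro card_subset_eq) auto
    then show ?thesis using top by simp
  qed
  have "0 \<le> (\<Sum>I\<in>subsets_upto (n - 1) n. \<Sum>J\<in>subsets_upto (n - 1) n.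
      v I * moment_matrix y I J * v J)"
    using y by (simp add: psd_on_def)
  also have "\<dots> = (\<Sum>I\<in>subsets_upto (n - 1) n. \<Sum>J\<in>Pow ?N. v I * moment_matrix y I J * v J)"
    by (intro sum.cong[OF refl] sum.mono_neutral_left sub) (simp_all add: outside)
  also have "\<dots> = (\<Sum>I\<in>Pow ?N. \<Sum>J\<in>Pow ?N. v I * moment_matrix y I J * v J)"
    by (intro sum.mono_neutral_left sub) (simp_all add: outside)
  also have "\<dots> = (\<Sum>S\<in>Pow ?N. z S * (sum v (Pow S))\<^sup>2)"
    by (rule moment_quadratic_form) (simp_all add: z)
  \<comment> \<open>Since \<open>A\<close> and \<open>B\<close> differ, \<open>g\<close> takes only
    the values 0 and 1 and equals its square.\<close>
  also have "\<dots> = (\<Sum>S\<in>Pow ?N. (if S = A then z A else 0) + (if S = B then z B else 0))"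
    using v \<open>A \<noteq> B\<close> by (intro sum.cong[OF refl]) (auto simp: g_def simp flip: v[rule_format])
  also have "\<dots> = z A + z B"
    using A B by (simp add: sum.distrib)
  finally show ?thesis .
qed

text \<open>Weight each pair inequality by \<open>h a * h b\<close> and sum. Both sides have the
  same mass, so the result is that mass times the claimed sum; if the mass is 0, \<open>h\<close>
  vanishes.\<close>

lemma weighted_sum_nonneg:
  fixes h z :: "'a \<Rightarrow> real"
  assumes fin: "finite E" "finite D"
    and h: "\<And>x. x \<in> E \<union> D \<Longrightarrow> 0 \<le> h x"
    and balanced: "sum h E = sum h D"
    and pair: "\<And>a b. a \<in> E \<Longrightarrow> b \<in> D \<Longrightarrow> 0 \<le> z a + z b"
  shows "0 \<le> (\<Sum>a\<in>E. z a * h a) + (\<Sum>b\<in>D. z b * h b)"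
proof (cases "sum h E = 0")
  case True
  then have "\<forall>a\<in>E. h a = 0" "\<forall>b\<in>D. h b = 0"
    using fin h balanced by (simp_all add: sum_nonneg_eq_0_iff)
  then show ?thesis by simp
next
  case False
  then have pos: "0 < sum h E" using h by (simp add: less_le sum_nonneg)
  have "0 \<le> (\<Sum>a\<in>E. \<Sum>b\<in>D. h a * h b * (z a + z b))"
    using h pair by (intro sum_nonneg mult_nonneg_nonneg) auto
  also have "\<dots> = (\<Sum>a\<in>E. \<Sum>b\<in>D. (z a * h a) * h b) + (\<Sum>a\<in>E. \<Sum>b\<in>D. h a * (z b * h b))"
    by (simp add: algebra_simps sum.distrib)
  also have "\<dots> = sum h E * ((\<Sum>a\<in>E. z a * h a) + (\<Sum>b\<in>D. z b * h b))"
    unfolding sum_product[symmetric] by (simp add: balanced algebra_simps)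
  finally show ?thesis using pos by (simp add: zero_le_mult_iff)
qed

lemma lasserre_objective_nonneg:
  assumes f: "\<And>x. x \<in> cube n \<Longrightarrow> 0 \<le> f x"
    and top: "multilinear_coeff n f {1..n} = 0"
    and y: "y \<in> lasserre_feasible n (n - 1)"
  shows "0 \<le> lasserre_objective n f y"
proof -
  let ?N = "{1..n}" and ?c = "multilinear_coeff n f"
  let ?E = "{S\<in>Pow ?N. even (card S)}" and ?D = "{S\<in>Pow ?N. odd (card S)}"
  define h where "h S = f (vertex n S)" for S
  have h: "h S = sum ?c (Pow S)" if "S \<subseteq> ?N" for S
    using that multilinear_rep_coeff[of n f] by (simp add: multilinear_rep_iff h_def)
  have split: "sum k (Pow ?N) = sum k ?E + sum k ?D" for k :: "nat set \<Rightarrow> real"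
    by (subst sum.union_disjoint[symmetric]) (auto intro!: sum.cong)
  obtain z where z: "\<And>I. I \<subseteq> ?N \<Longrightarrow> y I = (\<Sum>S\<in>Pow ?N. if I \<subseteq> S then z S else 0)"
    using superset_sums_exist[of ?N y] by blast
  have "0 = (\<Sum>S\<in>Pow ?N. (-1) ^ card S * h S)"
    using alternating_sum_subset_sums[of ?N ?c] top h by simp
  also have "\<dots> = sum h ?E - sum h ?D"
    unfolding split by (simp add: sum_negf)
  finally have balanced: "sum h ?E = sum h ?D" by simp
  have "lasserre_objective n f y = (\<Sum>I\<in>Pow ?N. ?c I * (\<Sum>S\<in>Pow ?N. if I \<subseteq> S then z S else 0))"
    unfolding lasserre_objective_def by (intro sum.cong[OF refl]) (use z in auto)
  also have "\<dots> = (\<Sum>S\<in>Pow ?N. z S * h S)"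
    by (simp add: sum_superset_sums h)
  also have "\<dots> = (\<Sum>S\<in>?E. z S * h S) + (\<Sum>S\<in>?D. z S * h S)"
    by (rule split)
  also have "\<dots> \<ge> 0"
  proof (rule weighted_sum_nonneg[OF _ _ _ balanced])
    show "0 \<le> h S" if "S \<in> ?E \<union> ?D" for S
      using that f by (auto simp: h_def cube_eq_vertices)
    show "0 \<le> z A + z B" if "A \<in> ?E" "B \<in> ?D" for A B
      using that y z by (intro feasible_pair_nonneg[of n y z]) (auto simp: lasserre_feasible_def)
  qed auto
  finally show ?thesis .
qed

lemma multilinear_degree_eq_dimension:
  assumes "multilinear_coeff n f {1..n} \<noteq> 0"
  shows "multilinear_degree n f = n"
  unfolding multilinear_degree_def
proof (rule Max_eqI)
  show "m \<le> n" if "m \<in> insert 0 (card ` {I. I \<subseteq> {1..n} \<and> multilinear_coeff n f I \<noteq> 0})" for m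
    using that card_mono[of "{1..n}"] by fastforce
  show "n \<in> insert 0 (card ` {I. I \<subseteq> {1..n} \<and> multilinear_coeff n f I \<noteq> 0})"
    using assms by (intro insertI2 image_eqI[of _ _ "{1..n}"]) auto
qed simp

theorem theorem3:
  fixes n :: nat and f :: "(nat \<Rightarrow> real) \<Rightarrow> real"
  assumes "Min (f ` cube n) = 0"
    and "Max (f ` cube n) = 1"
    and "integrality_gap n (n - 1) f"
  shows "multilinear_degree n f = n"
proof (rule multilinear_degree_eq_dimension, rule notI)
  assume top: "multilinear_coeff n f {1..n} = 0"
  have "finite (cube n)" by (simp add: cube_eq_vertices)
  then have "0 \<le> f x" if "x \<in> cube n" for x
    using that assms(1) Min_le[of "f ` cube n" "f x"] by simp
  \<comment> \<open>A lower bound on every feasible objective passes to the infimum, whether or not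
    it is attained.\<close>
  then have "0 \<le> lasserre_value n (n - 1) f"
    unfolding lasserre_value_def
    by (intro INF_greatest) (use lasserre_objective_nonneg top in simp)
  then show False
    using assms(1,3) by (simp add: integrality_gap_def zero_ereal_def)
qed

end
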